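(* Let $(A,B,C,D)$ be any of the vectors of exponents $(0,0,0,0)$, $(2,1,2,-1)$, $(0,1,0,1)$, $(2,0,2,-2)$, $(1,0,1,0)$, $(1,1,1,-1)$. Then for every integer $n\ge0$ the coefficient $$[2n+1]_q!\,[z^{2n+1}]\tan_q^{(A,B,C,D)}(z)$$ is divisible, as a polynomial in $q$, by $$(1+q)(1+q^2)\cdots(1+q^n).$$
   Context: Here $q$ is an indeterminate, $[n]_q=\frac{1-q^n}{1-q}=1+q+\cdots+q^{n-1}$, $[n]_q!=[1]_q[2]_q\cdots[n]_q$, $[0]_q!=1$, and $[z^m]f(z)$ denotes the coefficient of $z^m$ in the power series $f(z)$. For a vector of exponents $(A,B,C,D)$ define the power series in $z$ $$\sin_q(z)=\sum_{n\ge0}\frac{(-1)^nz^{2n+1}}{[2n+1]_q!}q^{An^2+Bn},\qquad \cos_q(z)=\sum_{n\ge0}\frac{(-1)^nz^{2n}}{[2n]_q!}q^{Cn^2+Dn},$$ and $\tan_q^{(A,B,C,D)}(z)=\sin_q(z)/\cos_q(z)$. For the listed vectors the quantities $[2n+1]_q!\,[z^{2n+1}]\tan_q^{(A,B,C,D)}(z)$ are polynomials in $q$ with integer coefficients, and divisibility is in $\mathbb{Z}[q]$. An empty product (the case $n=0$) equals $1$. *)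

theory Defs
  imports "HOL-Computational_Algebra.Computational_Algebra"
begin

text \<open>
  All computations take place in the field of fractions of the polynomial ring over the integers
  in the indeterminate \<open>q\<close>, so that the quotients by \<open>q\<close>-factorials make sense.
\<close>

definition q_var :: "int poly fract" where
  "q_var = to_fract [:0, 1:]"

definition q_int :: "nat \<Rightarrow> int poly fract" where
  "q_int n = (1 - q_var ^ n) / (1 - q_var)"

definition q_fact :: "nat \<Rightarrow> int poly fract" where
  "q_fact n = (\<Prod>i=1..n. q_int i)"

text \<open>
  The power series in \<open>z\<close>: the coefficient of \<open>z ^ m\<close> has summation index \<open>n = m div 2\<close>.
  The parameters may be negative, hence the integer exponents of \<open>q\<close>.
\<close>

definition sin_q :: "int \<Rightarrow> int \<Rightarrow> int poly fract fps" where
  "sin_q A B = Abs_fps (\<lambda>m. if odd m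
     then (let n = m div 2 in
       (- 1) ^ n / q_fact (2 * n + 1) * q_var powi (A * int n ^ 2 + B * int n))
     else 0)"

definition cos_q :: "int \<Rightarrow> int \<Rightarrow> int poly fract fps" where
  "cos_q C D = Abs_fps (\<lambda>m. if even m
     then (let n = m div 2 in
       (- 1) ^ n / q_fact (2 * n) * q_var powi (C * int n ^ 2 + D * int n))
     else 0)"

definition tan_q :: "int \<times> int \<times> int \<times> int \<Rightarrow> int poly fract fps" where
  "tan_q = (\<lambda>(A, B, C, D). sin_q A B / cos_q C D)"

lemma q_var_neq_1: "q_var \<noteq> 1"
proof
  assume "q_var = 1"
  then have "to_fract [:0, 1::int:] = to_fract 1"
    by (simp add: q_var_def)
  then show False
    by (simp only: to_fract_eq_iff) (simp add: one_pCons)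
qed

lemma q_int_eq_sum: "q_int n = (\<Sum>i<n. q_var ^ i)"
  using q_var_neq_1 by (simp add: q_int_def one_diff_power_eq)

lemma cos_q_nth_0: "fps_nth (cos_q C D) 0 = 1"
  by (simp add: cos_q_def q_fact_def)

lemma tan_q_times_cos_q: "tan_q (A, B, C, D) * cos_q C D = sin_q A B"
proof -
  have "is_unit (cos_q C D)"
    by (simp add: cos_q_nth_0)
  then show ?thesis
    by (simp add: tan_q_def)
qed

end

theory Submission
  imports Defs
begin

text \<open>
  For each of the six vectors, the first-order \<open>q\<close>-difference equations of sine and cosine turn
  into a single equation for \<open>t = tan_q\<close>,
  \<open>t(z) - t(qz) = w (1 + c t(z) t(qz)) + w\<^sup>2 (b t(z) + b' t(qz))\<close> with \<open>w = (1 - q) z\<close>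
  and constants \<open>c, b, b'\<close>. For the coefficients \<open>T\<^sub>n = [2n+1]! [z^(2n+1)] t\<close> this means that \<open>T\<^sub>n\<close>
  is a combination of the products \<open>[2n choose 2i+1] T\<^sub>i T\<^sub>j\<close> with \<open>i + j = n - 1\<close> and of
  \<open>(1 - q^(2n)) T\<^sub>n\<^sub>-\<^sub>1\<close>. With \<open>D\<^sub>n = (1 + q) \<dots> (1 + q^n)\<close>, the factor \<open>1 - q^(2n)\<close> supplies
  \<open>1 + q^n\<close>, and \<open>D\<^sub>n\<close> divides \<open>[2n choose 2i+1] D\<^sub>i D\<^sub>j\<close>, so that divisibility follows by induction.
\<close>

section \<open>q-integers and q-factorials as integer polynomials\<close>

definition qn :: "nat \<Rightarrow> int poly" where
  "qn n = (\<Sum>i<n. [:0, 1:] ^ i)"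

definition qfact :: "nat \<Rightarrow> int poly" where
  "qfact n = (\<Prod>i=1..n. qn i)"

text \<open>The q-analogue of the double factorial (2n-1)!!.\<close>

definition qodd :: "nat \<Rightarrow> int poly" where
  "qodd n = (\<Prod>i<n. qn (2 * i + 1))"

definition qplus :: "nat \<Rightarrow> int poly" where
  "qplus n = (\<Prod>i=1..n. 1 + [:0, 1:] ^ i)"

lemma qn_add: "qn (m + n) = qn m + [:0, 1:] ^ m * qn n"
  by (induction n) (simp_all add: qn_def power_add algebra_simps)

lemma qn_double: "qn (2 * n) = (1 + [:0, 1:] ^ n) * qn n"
  using qn_add[of n n] by (simp add: mult_2 distrib_right)

lemma qn_mult_diff: "(1 - [:0, 1:]) * qn n = 1 - [:0, 1:] ^ n"
  by (simp only: qn_def one_diff_power_eq)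

lemma qfact_0 [simp]: "qfact 0 = 1"
  by (simp add: qfact_def)

lemma qfact_Suc: "qfact (Suc n) = qn (Suc n) * qfact n"
  by (simp add: qfact_def)

lemma qplus_Suc: "qplus (Suc n) = (1 + [:0, 1:] ^ Suc n) * qplus n"
  by (simp add: qplus_def)

text \<open>Integrality of the q-binomial coefficients. The q-Pascal rule, which is
  \<open>qn_add\<close> times [m+n-1]!, writes [m+n]! as a sum of two terms, each divisible by
  induction.\<close>

lemma qfact_mult_dvd: "qfact m * qfact n dvd qfact (m + n)"
proof (induction "m + n" arbitrary: m n)
  case (Suc k)
  show ?case
  proof (cases "m = 0 \<or> n = 0")
    case False
    then obtain a b where ab: "m = Suc a" "n = Suc b"
      by (metis not0_implies_Suc)
    have "qfact a * qfact n dvd qfact k" "qfact m * qfact b dvd qfact k"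
      using Suc.hyps(1)[of a n] Suc.hyps(1)[of m b] Suc.hyps(2) ab by auto
    then have "qn m * (qfact a * qfact n) dvd qn m * qfact k"
        "qn n * (qfact m * qfact b) dvd qn n * qfact k"
      by (simp_all only: mult_dvd_mono dvd_refl)
    then have "qfact m * qfact n dvd qn m * qfact k" "qfact m * qfact n dvd qn n * qfact k"
      unfolding ab qfact_Suc by (simp_all only: mult_ac)
    then have "qfact m * qfact n dvd qn m * qfact k + [:0, 1:] ^ m * (qn n * qfact k)"
      by (simp add: dvd_add dvd_mult)
    also have "\<dots> = qfact (m + n)"
      using Suc.hyps(2) by (metis qfact_Suc qn_add distrib_right mult.assoc)
    finally show ?thesis .
  qed auto
qed simp

text \<open>Since [2k] = (1 + q^k) [k], the even-indexed factors contribute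
  \<open>qplus n * qfact n\<close> and the odd-indexed ones \<open>qodd n\<close>.\<close>

lemma qfact_even: "qfact (2 * n) = qodd n * qplus n * qfact n"
proof (induction n)
  case (Suc n)
  have "qfact (2 * Suc n) = qn (2 * Suc n) * (qn (2 * n + 1) * qfact (2 * n))"
    by (simp add: qfact_Suc)
  then show ?case
    using Suc by (simp only: qn_double) (simp add: qfact_Suc qplus_Suc qodd_def mult_ac)
qed (simp add: qodd_def qplus_def)

lemma qfact_odd: "qfact (2 * n + 1) = qodd (Suc n) * qplus n * qfact n"
  using qfact_even[of n] by (simp add: qfact_Suc qodd_def mult_ac)

lemma qn_nz: "n > 0 \<Longrightarrow> qn n \<noteq> 0"
proof
  assume "n > 0" "qn n = 0"
  \<comment> \<open>At q = 1 the q-integer takes the value n.\<close>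
  then have "poly (qn n) 1 = 0" by simp
  then show False using \<open>n > 0\<close> by (simp add: qn_def poly_sum)
qed

lemma qfact_nz: "qfact n \<noteq> 0"
  by (auto simp: qfact_def qn_nz)

section \<open>Divisibility of q-binomial coefficients by \<open>qplus\<close>\<close>

lemma one_plus_dvd_one_plus_odd_power:
  fixes x :: "'a :: comm_ring_1"
  assumes "odd n"
  shows "1 + x dvd 1 + x ^ n"
proof -
  have "1 - (- x) dvd 1 - (- x) ^ n"
    unfolding one_diff_power_eq by (rule dvd_triv_left)
  then show ?thesis using assms by simp
qed

text \<open>With N = k (2i+1), a common divisor of 1 + q^k and [2i+1] divides both 1 + q^N and 1 -
  q^N, the former because 2i+1 is odd. Hence it divides their sum 2.\<close>

lemma coprime_qplus_qodd: "coprime (qplus m) (qodd n)"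
proof -
  have "coprime (1 + [:0, 1:] ^ k) (qn (2 * i + 1))" if "k > 0" for k i
  proof (rule coprimeI)
    fix c :: "int poly"
    let ?X = "[:0, 1:] :: int poly"
    assume c1: "c dvd 1 + ?X ^ k" and c2: "c dvd qn (2 * i + 1)"
    have "c dvd 1 - ?X ^ (2 * i + 1)"
      using c2 by (metis qn_mult_diff dvd_mult)
    also have "\<dots> dvd 1 - (?X ^ (2 * i + 1)) ^ k"
      by (simp only: one_diff_power_eq dvd_triv_left)
    finally have a: "c dvd 1 - ?X ^ (k * (2 * i + 1))"
      by (metis power_mult mult.commute)
    have "1 + ?X ^ k dvd 1 + (?X ^ k) ^ (2 * i + 1)"
      by (rule one_plus_dvd_one_plus_odd_power) simp
    then have b: "c dvd 1 + ?X ^ (k * (2 * i + 1))"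
      unfolding power_mult by (rule dvd_trans[OF c1])
    have "c dvd 2"
      using dvd_add[OF a b] by simp
    then have "degree c = 0"
      using dvd_imp_degree_le[of c 2] by simp
    then obtain a where "c = [:a:]" by (meson degree_0_id degree_eq_zeroE)
    \<comment> \<open>Only constants remain; the leading coefficient 1 of 1 + q^k rules out the
      non-unit 2.\<close>
    then have "a dvd coeff (1 + ?X ^ k) k"
      using c1 by (simp only: const_poly_dvd_iff)
    also have "coeff (1 + ?X ^ k) k = 1"
    proof -
      have "?X ^ k = monom 1 k" by (simp add: monom_altdef)
      then show ?thesis using that by simp
    qed
    finally show "is_unit c" using \<open>c = [:a:]\<close> by (simp add: is_unit_const_poly_iff)
  qed
  then show ?thesis
    unfolding qplus_def qodd_def by (intro prod_coprime_left prod_coprime_right) auto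
qed

text \<open>Up to the odd factors \<open>[2k+1]\<close>, which are coprime to \<open>qplus\<close>, the quotient is
  \<open>qfact n\<close> divided by \<open>qfact i * qfact j\<close>.\<close>

lemma qplus_dvd:
  assumes "n = i + j + 1"
  shows "qplus n * (qfact (2 * i + 1) * qfact (2 * j + 1)) dvd qfact (2 * n) * (qplus i * qplus j)"
proof -
  have "qfact i * qfact j dvd qfact n"
    using qfact_mult_dvd[of i j] assms by (simp add: qfact_Suc)
  then obtain B where B: "qfact n = qfact i * qfact j * B" ..
  define O' where "O' = qodd (Suc i) * qodd (Suc j)"
  have "qfact (2 * i + 1) * qfact (2 * j + 1) dvd qfact (2 * i + 1 + (2 * j + 1))"
    by (rule qfact_mult_dvd)
  also have "2 * i + 1 + (2 * j + 1) = 2 * n" using assms by simp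
  finally have "qfact i * qfact j * (O' * (qplus i * qplus j)) dvd qfact i * qfact j * (qplus n * (qodd n * B))"
    unfolding qfact_even qfact_odd B O'_def by (simp add: mult_ac)
  then have "O' * (qplus i * qplus j) dvd qplus n * (qodd n * B)"
    by (simp add: qfact_nz)
  then have "O' dvd qplus n * (qodd n * B)"
    by (rule dvd_mult_left)
  moreover have "coprime O' (qplus n)"
    using coprime_qplus_qodd by (simp add: O'_def coprime_commute[of "qodd _"])
  ultimately have "O' dvd qodd n * B"
    by (simp add: coprime_dvd_mult_right_iff)
  \<comment> \<open>Once \<open>qfact_even\<close> and \<open>qfact_odd\<close> are inserted, both
    sides of the goal share this first factor.\<close>
  then have "(qplus n * qplus i * qplus j * qfact i * qfact j) * O' dvd
      (qplus n * qplus i * qplus j * qfact i * qfact j) * (qodd n * B)"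
    by (rule mult_dvd_mono[OF dvd_refl])
  then show ?thesis
    unfolding qfact_even qfact_odd B O'_def by (simp add: mult_ac)
qed

section \<open>Passage to the fraction field\<close>

lemma to_fract_power: "to_fract (p ^ n) = to_fract p ^ n"
  by (induction n) simp_all

lemma q_fact_eq: "q_fact n = to_fract (qfact n)"
proof (induction n)
  case (Suc n)
  have "q_int k = to_fract (qn k)" for k
    by (simp only: q_int_eq_sum qn_def to_fract_sum to_fract_power q_var_def)
  with Suc show ?case
    by (simp add: q_fact_def qfact_Suc)
qed (simp add: q_fact_def)

lemma q_fact_nz: "q_fact n \<noteq> 0"
  by (simp add: q_fact_eq qfact_nz)

lemma q_fact_Suc: "(1 - q_var) * q_fact (Suc n) = (1 - q_var ^ Suc n) * q_fact n"
  using q_var_neq_1 by (simp add: q_fact_def q_int_def)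

lemma q_var_nz: "q_var \<noteq> 0"
  by (simp add: q_var_def)

section \<open>Dilation and q-difference equations of sine and cosine\<close>

definition dilate :: "int poly fract fps \<Rightarrow> int poly fract fps" where
  "dilate f = f oo (fps_const q_var * fps_X)"

lemma dilate_nth [simp]: "fps_nth (dilate f) n = q_var ^ n * fps_nth f n"
  by (simp add: dilate_def)

lemma dilate_mult: "dilate (f * g) = dilate f * dilate g"
  by (simp add: dilate_def fps_compose_mult_distrib)

abbreviation scaled_X :: "int poly fract fps" where
  "scaled_X \<equiv> fps_const (1 - q_var) * fps_X"

lemma q_var_power: "q_var ^ n = to_fract ([:0, 1:] ^ n)"
  by (simp add: q_var_def to_fract_power)

lemma q_power_eq_powi: "q_var ^ n = q_var powi int n"
  by simp

text \<open>The factor q^(2k+1) from dilation splits into q^(2k), which raises the linear exponent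
  by 2, and one leftover q. For cosine nothing is left over.\<close>

lemma sin_q_dilate: "dilate (sin_q A B) = fps_const q_var * sin_q A (B + 2)"
proof (rule fps_ext)
  fix m
  show "fps_nth (dilate (sin_q A B)) m = fps_nth (fps_const q_var * sin_q A (B + 2)) m"
  proof (cases "odd m")
    case True
    then obtain k where m: "m = 2 * k + 1" by (elim oddE)
    have "q_var ^ m * q_var powi (A * int k ^ 2 + B * int k) =
        q_var * q_var powi (A * int k ^ 2 + (B + 2) * int k)"
      using q_var_nz unfolding m q_power_eq_powi
      by (simp add: power_int_add [symmetric] power_int_add_1' [symmetric] algebra_simps)
    then show ?thesis using m by (simp add: sin_q_def)
  qed (simp add: sin_q_def)
qed

lemma cos_q_dilate: "dilate (cos_q C D) = cos_q C (D + 2)"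
proof (rule fps_ext)
  fix m
  show "fps_nth (dilate (cos_q C D)) m = fps_nth (cos_q C (D + 2)) m"
  proof (cases "even m")
    case True
    then obtain k where m: "m = 2 * k" by (elim evenE)
    have "q_var ^ m * q_var powi (C * int k ^ 2 + D * int k) =
        q_var powi (C * int k ^ 2 + (D + 2) * int k)"
      using q_var_nz unfolding m q_power_eq_powi
      by (simp add: power_int_add [symmetric] algebra_simps)
    then show ?thesis using m by (simp add: cos_q_def)
  qed (simp add: cos_q_def)
qed

lemma q_diff_div_q_fact: "(1 - q_var ^ Suc m) / q_fact (Suc m) = (1 - q_var) / q_fact m"
  using q_fact_Suc[of m] by (simp add: q_fact_nz divide_simps mult.commute)

text \<open>The factor 1 - q^m lowers the factorial from [m]! to [m-1]!, so the sine terms become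
  cosine terms with the same summation index and exponents.\<close>

lemma sin_q_diff: "sin_q A B - dilate (sin_q A B) = scaled_X * cos_q A B"
proof (rule fps_ext)
  fix m
  show "fps_nth (sin_q A B - dilate (sin_q A B)) m = fps_nth (scaled_X * cos_q A B) m"
  proof (cases "odd m")
    case True
    then obtain k where m: "m = Suc (2 * k)" by (elim oddE) simp
    let ?c = "(- 1) ^ k * q_var powi (A * int k ^ 2 + B * int k)"
    have "fps_nth (sin_q A B - dilate (sin_q A B)) m = (1 - q_var ^ m) / q_fact m * ?c"
      using m by (simp add: sin_q_def algebra_simps diff_divide_distrib)
    also have "\<dots> = fps_nth (scaled_X * cos_q A B) m"
      unfolding m q_diff_div_q_fact by (simp add: cos_q_def mult.assoc)
    finally show ?thesis .
  qed (cases m; simp add: sin_q_def cos_q_def mult.assoc)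
qed

lemma cos_q_diff:
  "cos_q C D - dilate (cos_q C D) = - scaled_X * fps_const (q_var powi (C + D)) * sin_q C (2 * C + D)"
proof (rule fps_ext)
  fix m
  show "fps_nth (cos_q C D - dilate (cos_q C D)) m =
    fps_nth (- scaled_X * fps_const (q_var powi (C + D)) * sin_q C (2 * C + D)) m"
  proof (cases "even m \<and> m > 0")
    case True
    then obtain k where m: "m = Suc (Suc (2 * k))"
      by (metis evenE gr0_conv_Suc mult_Suc_right mult_is_0 not_gr_zero add_2_eq_Suc)
    let ?c = "(- 1) ^ Suc k * q_var powi (C * int (Suc k) ^ 2 + D * int (Suc k))"
    have "fps_nth (cos_q C D - dilate (cos_q C D)) m = (1 - q_var ^ m) / q_fact m * ?c"
      using m by (simp add: cos_q_def algebra_simps diff_divide_distrib)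
    also have "\<dots> = - ((1 - q_var) * ((- 1) ^ k / q_fact (Suc (2 * k)) *
        q_var powi (C * int (Suc k) ^ 2 + D * int (Suc k))))"
      unfolding m q_diff_div_q_fact by simp
    \<comment> \<open>Here the summation index drops by one; completing the exponent for k produces
      the constant q^(C+D) and the new linear parameter 2C+D.\<close>
    also have "C * int (Suc k) ^ 2 + D * int (Suc k) = (C + D) + (C * int k ^ 2 + (2 * C + D) * int k)"
      by (simp add: algebra_simps power2_eq_square)
    also have "- ((1 - q_var) * ((- 1) ^ k / q_fact (Suc (2 * k)) * q_var powi \<dots>)) =
        fps_nth (- scaled_X * fps_const (q_var powi (C + D)) * sin_q C (2 * C + D)) m"
      using q_var_nz m by (simp add: sin_q_def power_int_add mult_ac del: minus_diff_eq flip: fps_const_neg)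
    finally show ?thesis .
  next
    case False
    then show ?thesis by (cases m) (auto simp: sin_q_def cos_q_def mult.assoc)
  qed
qed

section \<open>The functional equation of the tangent\<close>

text \<open>After multiplication by \<open>K * K1\<close> the equation is a polynomial identity in
  \<open>S\<close>, \<open>S1\<close>, \<open>K\<close>, \<open>K1\<close>, checked by eliminating
  two of them. Only \<open>c * q_var\<close> is claimed to be a polynomial, because the vector
  (2,0,2,-2) gives c = 1/q.\<close>

lemma tan_q_functional_equation:
  fixes A B C D :: int
  assumes "(A, B, C, D) \<in> {(0, 0, 0, 0), (2, 1, 2, -1), (0, 1, 0, 1),
                            (2, 0, 2, -2), (1, 0, 1, 0), (1, 1, 1, -1)}"
  defines "t \<equiv> tan_q (A, B, C, D)"
  shows "\<exists>c b b'. c * q_var \<in> range to_fract \<and> b \<in> range to_fract \<and> b' \<in> range to_fract \<and>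
    t - dilate t = scaled_X * (1 + fps_const c * t * dilate t)
      + scaled_X ^ 2 * (fps_const b * t + fps_const b' * dilate t)"
proof -
  define S where "S = sin_q A B"
  define K where "K = cos_q C D"
  define S1 where "S1 = dilate S"
  define K1 where "K1 = dilate K"
  define t1 where "t1 = dilate t"
  have tS: "t * K = S"
    unfolding t_def K_def S_def by (rule tan_q_times_cos_q)
  have t1S: "t1 * K1 = S1"
    unfolding t1_def K1_def S1_def tS [symmetric] by (simp add: dilate_mult)
  have "fps_nth (K * K1) 0 \<noteq> 0"
    by (simp add: K_def K1_def cos_q_nth_0)
  then have nz: "K * K1 \<noteq> 0" by auto
  have dS: "S - S1 = scaled_X * cos_q A B"
    unfolding S_def S1_def by (rule sin_q_diff)
  have dK: "K - K1 = - scaled_X * fps_const (q_var powi (C + D)) * sin_q C (2 * C + D)"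
    unfolding K_def K1_def by (rule cos_q_diff)
  have S1: "S1 = fps_const q_var * sin_q A (B + 2)" and K1: "K1 = cos_q C (D + 2)"
    unfolding S1_def K1_def S_def K_def by (rule sin_q_dilate cos_q_dilate)+
  have *: ?thesis if "c * q_var \<in> range to_fract" "b \<in> range to_fract" "b' \<in> range to_fract"
    and rel: "S * K1 - S1 * K = scaled_X * (K * K1 + fps_const c * S * S1)
      + scaled_X ^ 2 * (fps_const b * S * K1 + fps_const b' * S1 * K)" for c b b'
  proof -
    have "(K * K1) * (t - t1) =
      (K * K1) * (scaled_X * (1 + fps_const c * t * t1) + scaled_X ^ 2 * (fps_const b * t + fps_const b' * t1))"
      using rel unfolding tS [symmetric] t1S [symmetric] by (simp only: algebra_simps mult_1_left)
    then have "t - t1 = scaled_X * (1 + fps_const c * t * t1) + scaled_X ^ 2 * (fps_const b * t + fps_const b' * t1)"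
      using nz by (simp only: mult_cancel_left) simp
    with that show ?thesis unfolding t1_def by blast
  qed
  have q: "q_var \<in> range to_fract"
    by (simp add: q_var_def)
  have one: "1 \<in> range (to_fract :: int poly \<Rightarrow> _)"
    by (rule range_eqI[of _ _ 1]) simp
  have zero: "0 \<in> range (to_fract :: int poly \<Rightarrow> _)"
    by (rule range_eqI[of _ _ 0]) simp
  have minus_one: "-1 \<in> range (to_fract :: int poly \<Rightarrow> _)"
    by (rule range_eqI[of _ _ "-1"]) simp
  have qq: "q_var * q_var \<in> range to_fract"
    unfolding q_var_def to_fract_mult [symmetric] by (rule rangeI)
  from assms(1) show ?thesis
  proof (elim insertE emptyE, goal_cases)
    case 1
    then have e: "S1 = S - scaled_X * K" "K1 = K + scaled_X * S"
      using dS dK by (simp_all add: S_def K_def algebra_simps)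
    have "S * K1 - S1 * K = scaled_X * (K * K1 + fps_const 1 * S * S1)
      + scaled_X ^ 2 * (fps_const 0 * S * K1 + fps_const 0 * S1 * K)"
      unfolding e by (simp add: algebra_simps)
    then show ?thesis
      \<comment> \<open>The rotation puts \<open>rel\<close> first, so that the identity just proved
        determines \<open>c\<close>, \<open>b\<close> and \<open>b'\<close>.\<close>
      by (rule *[rotated 3]) (use q one zero minus_one qq q_var_nz in simp_all)
  next
    case 2
    then have "S - S1 = scaled_X * K1" "K - K1 = - scaled_X * S1"
      using dS dK S1 K1 by (simp_all add: mult.assoc)
    then have e: "S = S1 + scaled_X * K1" "K = K1 - scaled_X * S1"
      by (simp_all add: algebra_simps)
    have "S * K1 - S1 * K = scaled_X * (K * K1 + fps_const 1 * S * S1)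
      + scaled_X ^ 2 * (fps_const 0 * S * K1 + fps_const 0 * S1 * K)"
      unfolding e by (simp add: algebra_simps)
    then show ?thesis
      by (rule *[rotated 3]) (use q one zero minus_one qq q_var_nz in simp_all)
  next
    case 3
    then have e: "S1 = S - scaled_X * K" "K1 = K + scaled_X * fps_const q_var * S"
      using dS dK by (simp_all add: S_def K_def algebra_simps)
    have "S * K1 - S1 * K = scaled_X * (K * K1 + fps_const q_var * S * S1)
      + scaled_X ^ 2 * (fps_const 0 * S * K1 + fps_const 0 * S1 * K)"
      unfolding e by (simp add: algebra_simps)
    then show ?thesis
      by (rule *[rotated 3]) (use q one zero minus_one qq q_var_nz in simp_all)
  next
    case 4
    \<comment> \<open>Here C + D = 0, so no power of q offsets the one from
      \<open>sin_q_dilate\<close>; in case 2, C + D = 1 does.\<close>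
    have "sin_q 2 2 = fps_const (inverse q_var) * S1"
      using 4 S1 q_var_nz by (simp add: mult.assoc [symmetric])
    then have e: "S = S1 + scaled_X * K1" "K = K1 - scaled_X * fps_const (inverse q_var) * S1"
      using 4 dS dK K1 by (simp_all add: algebra_simps)
    have "S * K1 - S1 * K = scaled_X * (K * K1 + fps_const (inverse q_var) * S * S1)
      + scaled_X ^ 2 * (fps_const 0 * S * K1 + fps_const 0 * S1 * K)"
      unfolding e by (simp add: algebra_simps)
    then show ?thesis
      by (rule *[rotated 3]) (use q one zero minus_one qq q_var_nz in simp_all)
  next
    case 5
    \<comment> \<open>One difference involves an undilated series and the other a dilated one. This
      mixture creates the quadratic term in \<open>scaled_X\<close>, here and in case 6.\<close>
    then have "S - S1 = scaled_X * K" "K - K1 = - scaled_X * S1"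
      using dS dK S1 by (simp_all add: K_def mult.assoc)
    then have e: "S = S1 + scaled_X * K" "K1 = K + scaled_X * S1"
      by (simp_all add: algebra_simps)
    have "S * K1 - S1 * K = scaled_X * (K * K1 + fps_const 1 * S * S1)
      + scaled_X ^ 2 * (fps_const 0 * S * K1 + fps_const (-1) * S1 * K)"
      unfolding e by (simp add: algebra_simps power2_eq_square del: fps_const_mult flip: fps_const_neg)
    then show ?thesis
      by (rule *[rotated 3]) (use q one zero minus_one qq q_var_nz in simp_all)
  next
    case 6
    then have e: "S1 = S - scaled_X * K1" "K = K1 - scaled_X * S"
      using dS dK K1 by (simp_all add: S_def algebra_simps)
    have "S * K1 - S1 * K = scaled_X * (K * K1 + fps_const 1 * S * S1)
      + scaled_X ^ 2 * (fps_const 1 * S * K1 + fps_const 0 * S1 * K)"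
      unfolding e by (simp add: algebra_simps power2_eq_square del: fps_const_mult)
    then show ?thesis
      by (rule *[rotated 3]) (use q one zero minus_one qq q_var_nz in simp_all)
  qed
qed

section \<open>Recurrence for the coefficients\<close>

text \<open>Compare coefficients of z^(k+1), multiply by [k]! and use (1-q) [k+1]! = (1-q^(k+1))
  [k]!. In the quadratic term the second factor 1-q turns [k]! into (1-q^k) [k-1]!.\<close>

lemma functional_equation_recurrence:
  assumes eq: "t - dilate t = scaled_X * (1 + fps_const c * t * dilate t)
      + scaled_X ^ 2 * (fps_const b * t + fps_const b' * dilate t)"
  shows "q_fact (Suc k) * fps_nth t (Suc k) =
    (if k = 0 then 1 else 0)
    + (\<Sum>i=0..k. c * q_var ^ (k - i) * (q_fact k * fps_nth t i * fps_nth t (k - i)))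
    + (if k = 0 then 0 else (b + b' * q_var ^ (k - 1)) * (1 - q_var ^ k)
        * (q_fact (k - 1) * fps_nth t (k - 1)))"
proof -
  let ?f = "1 + fps_const c * (t * dilate t) + scaled_X * (fps_const b * t + fps_const b' * dilate t)"
  have "t - dilate t = fps_const (1 - q_var) * (fps_X * ?f)"
    unfolding eq by (simp only: power2_eq_square ring_distribs mult_ac)
  then have "fps_nth (t - dilate t) (Suc k) = (1 - q_var) * fps_nth ?f k"
    by simp
  then have "(1 - q_var ^ Suc k) * fps_nth t (Suc k) = (1 - q_var) * fps_nth ?f k"
    by (simp add: algebra_simps)
  moreover have "(1 - q_var) * (q_fact (Suc k) * fps_nth t (Suc k)) =
      q_fact k * ((1 - q_var ^ Suc k) * fps_nth t (Suc k))"
    by (simp only: mult.assoc [symmetric] q_fact_Suc) (simp only: mult_ac)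
  ultimately have "(1 - q_var) * (q_fact (Suc k) * fps_nth t (Suc k)) = q_fact k * ((1 - q_var) * fps_nth ?f k)"
    by simp
  then have "q_fact (Suc k) * fps_nth t (Suc k) = q_fact k * fps_nth ?f k"
    unfolding mult.left_commute[of _ "1 - q_var"] using q_var_neq_1 by simp
  also have "\<dots> = q_fact k * fps_nth 1 k + q_fact k * (c * fps_nth (t * dilate t) k)
      + q_fact k * fps_nth (scaled_X * (fps_const b * t + fps_const b' * dilate t)) k"
    by (simp add: distrib_left)
  also have "q_fact k * fps_nth 1 k = (if k = 0 then 1 else 0)"
    by (simp add: q_fact_def)
  also have "q_fact k * (c * fps_nth (t * dilate t) k) =
      (\<Sum>i=0..k. c * q_var ^ (k - i) * (q_fact k * fps_nth t i * fps_nth t (k - i)))"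
    by (simp add: fps_mult_nth sum_distrib_left mult_ac)
  also have "q_fact k * fps_nth (scaled_X * (fps_const b * t + fps_const b' * dilate t)) k =
      (if k = 0 then 0 else (b + b' * q_var ^ (k - 1)) * (1 - q_var ^ k)
        * (q_fact (k - 1) * fps_nth t (k - 1)))"
  proof (cases k)
    case (Suc l)
    have "q_fact k * fps_nth (scaled_X * (fps_const b * t + fps_const b' * dilate t)) k
        = (1 - q_var) * q_fact (Suc l) * ((b + b' * q_var ^ l) * fps_nth t l)"
      using Suc by (simp add: mult.assoc distrib_right mult.left_commute)
    then show ?thesis
      unfolding q_fact_Suc using Suc by (simp add: mult_ac)
  qed simp
  finally show ?thesis .
qed

section \<open>Divisibility by induction\<close>

text \<open>The value \<open>0\<close> at even indices encodes that the tangent is an odd series.\<close>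

definition tan_divisor :: "nat \<Rightarrow> int poly" where
  "tan_divisor m = (if odd m then qplus (m div 2) else 0)"

text \<open>The ideal of Z[q] generated by \<open>tan_divisor m\<close>, embedded in the fraction
  field: membership asserts integrality and divisibility at once.\<close>

definition tan_ideal :: "nat \<Rightarrow> int poly fract set" where
  "tan_ideal m = range (\<lambda>r. to_fract (tan_divisor m * r))"

lemma tan_idealI: "x = to_fract (tan_divisor m * r) \<Longrightarrow> x \<in> tan_ideal m"
  unfolding tan_ideal_def by (rule range_eqI)

lemma tan_ideal_0: "0 \<in> tan_ideal m"
  by (rule tan_idealI[of _ _ 0]) simp

lemma tan_ideal_add: "x \<in> tan_ideal m \<Longrightarrow> y \<in> tan_ideal m \<Longrightarrow> x + y \<in> tan_ideal m"
proof -
  assume "x \<in> tan_ideal m" "y \<in> tan_ideal m"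
  then obtain r s where "x = to_fract (tan_divisor m * r)" "y = to_fract (tan_divisor m * s)"
    by (auto simp: tan_ideal_def)
  then have "x + y = to_fract (tan_divisor m * (r + s))"
    by (simp add: distrib_left)
  then show ?thesis
    by (rule tan_idealI)
qed

lemma tan_ideal_sum: "(\<And>i. i \<in> I \<Longrightarrow> f i \<in> tan_ideal m) \<Longrightarrow> sum f I \<in> tan_ideal m"
  by (induction I rule: infinite_finite_induct) (auto simp: tan_ideal_0 tan_ideal_add)

lemma tan_ideal_mult:
  assumes "x \<in> tan_ideal m" "c \<in> range to_fract"
  shows "c * x \<in> tan_ideal m"
proof -
  obtain r e where "x = to_fract (tan_divisor m * r)" "c = to_fract e"
    using assms by (auto simp: tan_ideal_def)
  then have "c * x = to_fract (tan_divisor m * (r * e))" by (simp add: mult_ac)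
  then show ?thesis by (rule tan_idealI)
qed

text \<open>For odd \<open>i\<close> and \<open>j\<close> the expression is a q-binomial coefficient
  times the two given elements, and \<open>qplus_dvd\<close> applies. Otherwise \<open>x\<close> or
  \<open>y\<close> vanishes, since the ideal of an even index is zero.\<close>

lemma q_binomial_product_in_tan_ideal:
  assumes x: "q_fact i * x \<in> tan_ideal i" and y: "q_fact j * y \<in> tan_ideal j"
  shows "q_fact (i + j) * x * y \<in> tan_ideal (Suc (i + j))"
proof (cases "odd i \<and> odd j")
  case True
  then obtain a b where ij: "i = 2 * a + 1" "j = 2 * b + 1" by (metis oddE)
  define n where "n = a + b + 1"
  have k: "i + j = 2 * n" "tan_divisor (Suc (i + j)) = qplus n"
    by (simp_all add: ij n_def tan_divisor_def)
  obtain g where g: "qfact (2 * n) * (qplus a * qplus b) = qplus n * (qfact i * qfact j) * g"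
    using qplus_dvd[OF n_def] unfolding ij by (rule dvdE)
  obtain r s where rs: "q_fact i * x = to_fract (qplus a * r)" "q_fact j * y = to_fract (qplus b * s)"
    using x y by (auto simp: tan_ideal_def tan_divisor_def ij)
  have "q_fact i * q_fact j * (q_fact (2 * n) * x * y) =
      to_fract (qfact (2 * n)) * (q_fact i * x) * (q_fact j * y)"
    by (simp add: q_fact_eq mult_ac)
  also have "\<dots> = to_fract (qfact (2 * n) * (qplus a * qplus b) * (r * s))"
    unfolding rs by (simp add: mult_ac)
  also have "\<dots> = q_fact i * q_fact j * to_fract (qplus n * (g * r * s))"
    unfolding g by (simp add: q_fact_eq mult_ac)
  finally have "q_fact (2 * n) * x * y = to_fract (qplus n * (g * r * s))"
    by (simp add: q_fact_nz)
  then show ?thesis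
    by (intro tan_idealI[of _ _ "g * r * s"]) (simp add: k(2), simp add: k(1))
next
  case False
  then have "x * y = 0"
    using x y q_fact_nz by (auto simp: tan_ideal_def tan_divisor_def)
  then show ?thesis by (auto simp: tan_ideal_0)
qed

text \<open>For m = 2a+1 the factor is 1 - q^(2a+2), and its divisor 1 + q^(a+1) extends
  \<open>qplus a\<close> to \<open>qplus (Suc a)\<close>.\<close>

lemma one_minus_q_power_in_tan_ideal:
  assumes "x \<in> tan_ideal m"
  shows "(1 - q_var ^ Suc m) * x \<in> tan_ideal (Suc (Suc m))"
proof (cases "odd m")
  case True
  then obtain a where m: "m = 2 * a + 1" by (elim oddE)
  obtain r where r: "x = to_fract (qplus a * r)"
    using assms by (auto simp: tan_ideal_def tan_divisor_def m)
  let ?X = "[:0, 1:] :: int poly"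
  have "Suc m = Suc a * 2" by (simp add: m)
  then have "1 - q_var ^ Suc m = to_fract (1 - (?X ^ Suc a) ^ 2)"
    by (simp only: q_var_power power_mult to_fract_power to_fract_diff to_fract_1)
  also have "1 - (?X ^ Suc a) ^ 2 = (1 + ?X ^ Suc a) * (1 - ?X ^ Suc a)"
    by (simp add: algebra_simps power2_eq_square)
  finally have "(1 - q_var ^ Suc m) * x = to_fract (qplus (Suc a) * ((1 - ?X ^ Suc a) * r))"
    unfolding r qplus_Suc to_fract_mult by (simp only: mult_ac)
  moreover have "tan_divisor (Suc (Suc m)) = qplus (Suc a)"
    by (simp add: m tan_divisor_def)
  ultimately show ?thesis
    by (intro tan_idealI) (simp only:)
next
  case False
  with assms have "x = 0" by (auto simp: tan_ideal_def tan_divisor_def)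
  then show ?thesis by (simp add: tan_ideal_0)
qed

lemma functional_equation_imp_tan_ideal:
  assumes eq: "t - dilate t = scaled_X * (1 + fps_const c * t * dilate t)
      + scaled_X ^ 2 * (fps_const b * t + fps_const b' * dilate t)"
    and c: "c * q_var \<in> range to_fract" and b: "b \<in> range to_fract" and b': "b' \<in> range to_fract"
    and t0: "fps_nth t 0 = 0"
  shows "q_fact m * fps_nth t m \<in> tan_ideal m"
proof (induction m rule: less_induct)
  case (less m)
  obtain e d d' where e: "c * q_var = to_fract e" and d: "b = to_fract d" "b' = to_fract d'"
    using c b b' by blast
  show ?case
  proof (cases m)
    case (Suc k)
    have "(if k = 0 then 1 else 0) \<in> tan_ideal (Suc k)"
      by (auto intro: tan_ideal_0 tan_idealI[of _ _ 1] simp: tan_divisor_def qplus_def)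
    moreover have "c * q_var ^ (k - i) * (q_fact k * fps_nth t i * fps_nth t (k - i)) \<in> tan_ideal (Suc k)"
      if "i \<in> {0..k}" for i
    \<comment> \<open>The summand with i = k carries no power of q but vanishes by
      \<open>t0\<close>; in all others one factor q clears the possible denominator of
      \<open>c\<close>.\<close>
    proof (cases "k - i")
      case 0
      then show ?thesis by (simp add: t0 tan_ideal_0)
    next
      case (Suc j)
      have "c * q_var ^ (k - i) = c * q_var * q_var ^ j"
        by (simp add: Suc mult.assoc)
      also have "\<dots> = to_fract (e * [:0, 1:] ^ j)"
        unfolding e q_var_power by simp
      finally have "c * q_var ^ (k - i) \<in> range to_fract"
        by (rule range_eqI)
      moreover have "q_fact (i + (k - i)) * fps_nth t i * fps_nth t (k - i) \<in> tan_ideal (Suc (i + (k - i)))"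
        using that less.IH \<open>m = Suc k\<close> by (intro q_binomial_product_in_tan_ideal) auto
      then have "q_fact k * fps_nth t i * fps_nth t (k - i) \<in> tan_ideal (Suc k)"
        using that by simp
      ultimately show ?thesis
        by (rule tan_ideal_mult [rotated])
    qed
    moreover have "(if k = 0 then 0 else (b + b' * q_var ^ (k - 1)) * (1 - q_var ^ k)
        * (q_fact (k - 1) * fps_nth t (k - 1))) \<in> tan_ideal (Suc k)"
    proof (cases k)
      case (Suc l)
      have "b + b' * q_var ^ l = to_fract (d + d' * [:0, 1:] ^ l)"
        by (simp add: d q_var_power)
      then have "b + b' * q_var ^ l \<in> range to_fract"
        by (rule range_eqI)
      moreover have "(1 - q_var ^ Suc l) * (q_fact l * fps_nth t l) \<in> tan_ideal (Suc (Suc l))"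
        using less.IH[of l] Suc \<open>m = Suc k\<close> by (intro one_minus_q_power_in_tan_ideal) auto
      ultimately have "(b + b' * q_var ^ l) * ((1 - q_var ^ Suc l) * (q_fact l * fps_nth t l))
          \<in> tan_ideal (Suc (Suc l))"
        by (rule tan_ideal_mult [rotated])
      then show ?thesis by (simp only: Suc) (simp add: mult.assoc)
    qed (simp add: tan_ideal_0)
    ultimately show ?thesis
      unfolding Suc functional_equation_recurrence[OF eq]
      by (intro tan_ideal_add tan_ideal_sum) auto
  qed (simp add: t0 tan_ideal_0)
qed

theorem theorem12:
  fixes A B C D :: int and n :: nat
  assumes "(A, B, C, D) \<in> {(0, 0, 0, 0), (2, 1, 2, -1), (0, 1, 0, 1),
                            (2, 0, 2, -2), (1, 0, 1, 0), (1, 1, 1, -1)}"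
  shows "\<exists>p :: int poly.
           q_fact (2 * n + 1) * fps_nth (tan_q (A, B, C, D)) (2 * n + 1) = to_fract p \<and>
           (\<Prod>i=1..n. 1 + [:0, 1:] ^ i) dvd p"
proof -
  let ?t = "tan_q (A, B, C, D)"
  \<comment> \<open>As cosine has constant term 1, the constant term of the tangent can be read off
    from this product.\<close>
  have "fps_nth (?t * cos_q C D) 0 = 0"
    unfolding tan_q_times_cos_q by (simp add: sin_q_def)
  then have "fps_nth ?t 0 = 0"
    by (simp add: cos_q_nth_0)
  then have "q_fact (2 * n + 1) * fps_nth ?t (2 * n + 1) \<in> tan_ideal (2 * n + 1)"
    using tan_q_functional_equation[OF assms] functional_equation_imp_tan_ideal by blast
  then obtain r where "q_fact (2 * n + 1) * fps_nth ?t (2 * n + 1) = to_fract (qplus n * r)"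
    by (auto simp: tan_ideal_def tan_divisor_def)
  then show ?thesis
    unfolding qplus_def by (metis dvd_triv_left)
qed

end
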